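(* Suppose that $A_i$ is normal and Hurwitz for each $i\in E$. Then, almost surely, $\|X_t\|\to 0$ monotonically as $t\to\infty$.
   Context: Let $E=\{0,1,\dots,n-1\}$ be a finite set and $\{A_i\}_{i\in E}$ a family of real $d\times d$ matrices. A matrix is Hurwitz if all its eigenvalues have strictly negative real part. Let $Q$ be an irreducible generator (rate matrix) on $E$, let $r>0$ be the switching rate, and let $(I_t)_{t\ge 0}$ be the continuous-time (right-continuous jump) Markov process on $E$ with generator $rQ$. Let $(X_t)_{t\ge0}$ be the $\mathbb{R}^d$-valued solution of $X_t=X_0+\int_0^t A_{I_s}X_s\,ds$ for $t\ge 0$, so that $(X_t,I_t)_{t\ge0}$ is a Markov process on $\mathbb{R}^d\times E$. The initial condition $(X_0,I_0)$ has some given law on $\mathbb{R}^d\times E$ with $\mathbb{E}\|X_0\|<\infty$. Here $\|\cdot\|$ is the Euclidean norm. *)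

theory Defs
  imports "HOL-Analysis.Analysis" "HOL-Probability.Probability"
begin

definition normal_matrix :: "real^'d^'d \<Rightarrow> bool" where
  "normal_matrix A \<longleftrightarrow> A ** transpose A = transpose A ** A"

text \<open>The spectrum of a real matrix is taken over the complex numbers.\<close>

definition complex_eigenvalue :: "real^'d^'d \<Rightarrow> complex \<Rightarrow> bool" where
  "complex_eigenvalue A z \<longleftrightarrow>
     (\<exists>v :: complex^'d. v \<noteq> 0 \<and> map_matrix complex_of_real A *v v = z *s v)"

definition hurwitz :: "real^'d^'d \<Rightarrow> bool" where
  "hurwitz A \<longleftrightarrow> (\<forall>z. complex_eigenvalue A z \<longrightarrow> Re z < 0)"

text \<open>
  Matrices indexed by the state space \<open>{..<n}\<close> are functions \<open>nat \<Rightarrow> nat \<Rightarrow> real\<close>, of which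
  only the entries with both indices below \<open>n\<close> matter.
\<close>

definition generator :: "nat \<Rightarrow> (nat \<Rightarrow> nat \<Rightarrow> real) \<Rightarrow> bool" where
  "generator n G \<longleftrightarrow>
     (\<forall>i<n. \<forall>j<n. i \<noteq> j \<longrightarrow> 0 \<le> G i j) \<and> (\<forall>i<n. (\<Sum>j<n. G i j) = 0)"

definition irreducible_generator :: "nat \<Rightarrow> (nat \<Rightarrow> nat \<Rightarrow> real) \<Rightarrow> bool" where
  "irreducible_generator n G \<longleftrightarrow>
     generator n G \<and>
     (\<forall>i<n. \<forall>j<n. (i, j) \<in> {(k, l). k < n \<and> l < n \<and> k \<noteq> l \<and> 0 < G k l}\<^sup>*)"

primrec matrix_pow :: "nat \<Rightarrow> (nat \<Rightarrow> nat \<Rightarrow> real) \<Rightarrow> nat \<Rightarrow> nat \<Rightarrow> nat \<Rightarrow> real" where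
  "matrix_pow n G 0 = (\<lambda>i j. if i = j then 1 else 0)"
| "matrix_pow n G (Suc k) = (\<lambda>i j. \<Sum>l<n. G i l * matrix_pow n G k l j)"

text \<open>The transition semigroup \<open>exp (t G)\<close> of the generator \<open>G\<close>, entrywise.\<close>

definition transition_prob ::
    "nat \<Rightarrow> (nat \<Rightarrow> nat \<Rightarrow> real) \<Rightarrow> real \<Rightarrow> nat \<Rightarrow> nat \<Rightarrow> real" where
  "transition_prob n G t i j = (\<Sum>k. t ^ k / fact k * matrix_pow n G k i j)"

text \<open>
  Right continuity is with respect to the discrete topology on the state space; the times at
  which the path is not locally constant to the left are its jump times, and only finitely
  many of them lie in a bounded interval. Values at negative times play no role.
\<close>

definition jump_path :: "(real \<Rightarrow> nat) \<Rightarrow> bool" where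
  "jump_path x \<longleftrightarrow>
     (\<forall>t\<ge>0. \<forall>\<^sub>F s in at_right t. x s = x t) \<and>
     (\<forall>T>0. finite {t. 0 < t \<and> t \<le> T \<and> \<not> (\<forall>\<^sub>F s in at_left t. x s = x t)})"

text \<open>The sigma-algebra generated by \<open>(X s, I s)\<close>, \<open>0 \<le> s \<le> t\<close>.\<close>

definition history ::
    "'w measure \<Rightarrow> nat \<Rightarrow> (real \<Rightarrow> 'w \<Rightarrow> real^'d) \<Rightarrow> (real \<Rightarrow> 'w \<Rightarrow> nat) \<Rightarrow> real \<Rightarrow> 'w measure" where
  "history M n X I t =
     sigma (space M)
       (\<Union>s\<in>{0..t}. {(\<lambda>\<omega>. (X s \<omega>, I s \<omega>)) -` B \<inter> space M | B.
                      B \<in> sets (borel \<Otimes>\<^sub>M count_space {..<n})})"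

text \<open>
  Jump Markov process on \<open>{..<n}\<close> with generator \<open>G\<close>, relative to the filtration \<open>F\<close>.
\<close>

definition markov_jump_process ::
    "'w measure \<Rightarrow> (real \<Rightarrow> 'w measure) \<Rightarrow> nat \<Rightarrow> (nat \<Rightarrow> nat \<Rightarrow> real) \<Rightarrow> (real \<Rightarrow> 'w \<Rightarrow> nat) \<Rightarrow> bool"
  where
  "markov_jump_process M F n G I \<longleftrightarrow>
     (\<forall>t\<ge>0. I t \<in> F t \<rightarrow>\<^sub>M count_space {..<n}) \<and>
     (\<forall>s\<ge>0. \<forall>t\<ge>0. \<forall>j<n. AE \<omega> in M.
        real_cond_exp M (F s) (indicator {\<omega> \<in> space M. I (s + t) \<omega> = j}) \<omega>
          = transition_prob n G t (I s \<omega>) j) \<and>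
     (AE \<omega> in M. jump_path (\<lambda>t. I t \<omega>))"

definition solves_switched_ode ::
    "(nat \<Rightarrow> real^'d^'d) \<Rightarrow> (real \<Rightarrow> nat) \<Rightarrow> (real \<Rightarrow> real^'d) \<Rightarrow> bool" where
  "solves_switched_ode A i x \<longleftrightarrow>
     (\<forall>t\<ge>0. (\<lambda>s. A (i s) *v x s) integrable_on {0..t} \<and>
             x t = x 0 + integral {0..t} (\<lambda>s. A (i s) *v x s))"

text \<open>
  The pair \<open>(X, I)\<close>: \<open>I\<close> is driven by its own generator and does not anticipate \<open>X\<close>, which is
  why its Markov property is required relative to the joint history; together with the integral
  equation this makes \<open>(X, I)\<close> a Markov process. The law of \<open>(X 0, I 0)\<close> is arbitrary.
\<close>

definition switched_system ::
    "'w measure \<Rightarrow> nat \<Rightarrow> (nat \<Rightarrow> nat \<Rightarrow> real) \<Rightarrow> (nat \<Rightarrow> real^'d^'d) \<Rightarrow>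
     (real \<Rightarrow> 'w \<Rightarrow> real^'d) \<Rightarrow> (real \<Rightarrow> 'w \<Rightarrow> nat) \<Rightarrow> bool" where
  "switched_system M n G A X I \<longleftrightarrow>
     (\<forall>t\<ge>0. X t \<in> borel_measurable M) \<and>
     (\<forall>t\<ge>0. I t \<in> M \<rightarrow>\<^sub>M count_space {..<n}) \<and>
     markov_jump_process M (history M n X I) n G I \<and>
     (AE \<omega> in M. solves_switched_ode A (\<lambda>t. I t \<omega>) (\<lambda>t. X t \<omega>))"

end

theory Submission
  imports Defs "HOL-Real_Asymp.Real_Asymp"
begin

text \<open>
  The conclusion holds for each trajectory of \<open>X\<close> that solves the integral equation driven by a
  jump path. The idea is that normality turns the spectral condition into a dissipation
  inequality \<open>v \<bullet> (A\<^sub>i v) \<le> - c \<parallel>v\<parallel>\<^sup>2\<close> in the Euclidean norm itself. For a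
  matrix that is only Hurwitz such an inequality holds in some norm that depends on the matrix,
  which is why switching between Hurwitz matrices can be unstable in general. Here the norm is the
  same for all states, and finitely many states allow a common \<open>c > 0\<close>
  (\<open>uniformly_dissipative_if_normal_hurwitz\<close>). Along a trajectory the derivative of
  \<open>\<parallel>x\<parallel>\<^sup>2\<close> is \<open>2 x \<bullet> (A\<^sub>i x) \<le> - 2 c \<parallel>x\<parallel>\<^sup>2\<close> away from the
  jump times, so \<open>exp (c t) \<parallel>x t\<parallel>\<close> decreases (\<open>switched_trajectory_decay\<close>).
  This gives monotonicity and exponential decay at once.

  For the dissipation inequality, let \<open>S = A + A\<^sup>T\<close> and \<open>K = A - A\<^sup>T\<close>, which
  commute because \<open>A\<close> is normal, and let \<open>m\<close> be the maximum of \<open>x \<bullet> S x\<close> on the unit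
  sphere. It is an eigenvalue of \<open>S\<close>, and \<open>K\<close> acts on its eigenspace. The square of the skew
  matrix \<open>K\<close> is symmetric, so it has an eigenvector \<open>w\<close> there. Out of \<open>w\<close> and \<open>K w\<close> one
  builds a complex eigenvector of \<open>A\<close> whose eigenvalue has real part \<open>m / 2\<close>. Hence \<open>m < 0\<close>,
  while \<open>x \<bullet> A x = x \<bullet> S x / 2 \<le> m \<parallel>x\<parallel>\<^sup>2 / 2\<close>.
\<close>

section \<open>Normal Hurwitz matrices are dissipative\<close>

text \<open>
  A maximiser of the Rayleigh quotient on the compact unit sphere of \<open>V\<close> is an eigenvector,
  because the first variation of \<open>m \<parallel>y\<parallel>\<^sup>2 - y \<bullet> f y \<ge> 0\<close> vanishes at a zero of that
  form. Restricting to an invariant subspace makes the lemma usable for commuting maps, one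
  inside an eigenspace of the other.
\<close>

lemma selfadjoint_max_eigenvector:
  fixes f :: "'a::euclidean_space \<Rightarrow> 'a"
  assumes f: "linear f" and V: "subspace V" "V \<noteq> {0}"
    and inv: "\<And>x. x \<in> V \<Longrightarrow> f x \<in> V"
    and sym: "\<And>x y. f x \<bullet> y = x \<bullet> f y"
  obtains m w where "w \<in> V" "norm w = 1" "f w = m *\<^sub>R w"
    "\<And>y. y \<in> V \<Longrightarrow> y \<bullet> f y \<le> m * (norm y)\<^sup>2"
proof -
  let ?K = "V \<inter> sphere 0 1"
  have "compact ?K"
    using closed_subspace[OF V(1)] by (simp add: closed_Int_compact)
  moreover have "?K \<noteq> {}"
  proof -
    obtain v where v: "v \<in> V" "v \<noteq> 0"
      using V subspace_0[OF V(1)] by blast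
    then have "(1 / norm v) *\<^sub>R v \<in> ?K"
      using V(1) by (simp add: subspace_scale)
    then show ?thesis by blast
  qed
  moreover have "continuous_on ?K (\<lambda>x. x \<bullet> f x)"
    by (intro continuous_intros linear_continuous_on linear_conv_bounded_linear[THEN iffD1] f)
  ultimately obtain w where w: "w \<in> ?K" and max: "\<And>y. y \<in> ?K \<Longrightarrow> y \<bullet> f y \<le> w \<bullet> f w"
    using continuous_attains_sup by metis
  define m where "m = w \<bullet> f w"
  have wV: "w \<in> V" and w1: "norm w = 1" using w by auto
  have le: "y \<bullet> f y \<le> m * (norm y)\<^sup>2" if "y \<in> V" for y
  proof (cases "y = 0")
    case False
    have "(1 / norm y) *\<^sub>R y \<in> ?K"
      using that False V(1) by (simp add: subspace_scale)
    from max[OF this] have "(y \<bullet> f y) / (norm y)\<^sup>2 \<le> m"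
      by (simp add: linear_cmul[OF f] m_def power2_eq_square)
    then show ?thesis using False by (simp add: divide_simps)
  qed (simp add: linear_0[OF f])
  define u where "u = m *\<^sub>R w - f w"
  have uV: "u \<in> V"
    unfolding u_def by (intro subspace_diff subspace_scale V wV inv)
  define q where "q = m * (norm u)\<^sup>2 - u \<bullet> f u"
  have quad: "0 \<le> 2 * t * (norm u)\<^sup>2 + t\<^sup>2 * q" for t
  proof -
    have "0 \<le> m * (norm (w + t *\<^sub>R u))\<^sup>2 - (w + t *\<^sub>R u) \<bullet> f (w + t *\<^sub>R u)"
      using le[of "w + t *\<^sub>R u"] uV wV V(1) by (simp add: subspace_add subspace_scale)
    also have "\<dots> = (m * (w \<bullet> w) - w \<bullet> f w) + 2 * t * ((m *\<^sub>R w - f w) \<bullet> u) + t\<^sup>2 * q"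
      using sym[of w u] unfolding q_def power2_norm_eq_inner
      by (simp add: linear_add[OF f] linear_cmul[OF f] inner_simps inner_commute
          algebra_simps power2_eq_square)
    also have "\<dots> = 2 * t * (norm u)\<^sup>2 + t\<^sup>2 * q"
      using w1 by (simp only: flip: u_def) (simp add: m_def power2_norm_eq_inner norm_eq_1)
    finally show ?thesis .
  qed
  have "u = 0"
  proof (rule ccontr)
    assume "u \<noteq> 0"
    then have p: "(norm u)\<^sup>2 > 0" by simp
    have q: "q \<ge> 0" using le[OF uV] by (simp add: q_def)
    \<comment> \<open>At the parameter \<open>- t\<close>, with \<open>t\<close> this small, the linear term dominates.\<close>
    define t where "t = (norm u)\<^sup>2 / (q + 1)"
    have t: "t > 0" "t * (q + 1) = (norm u)\<^sup>2" using p q by (auto simp: t_def)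
    have "2 * t * (norm u)\<^sup>2 \<le> t\<^sup>2 * q" using quad[of "- t"] by simp
    also have "\<dots> \<le> t * (t * (q + 1))"
      by (simp add: power2_eq_square algebra_simps)
    also have "\<dots> = t * (norm u)\<^sup>2" by (simp add: t)
    finally show False using t p by (simp add: mult_pos_pos)
  qed
  then have "f w = m *\<^sub>R w" by (simp add: u_def)
  with that wV w1 le show thesis by blast
qed

lemma inner_transpose: "(transpose B *v x) \<bullet> y = x \<bullet> (B *v y)" for B :: "real^'d^'d"
  by (metis dot_lmul_matrix transpose_matrix_vector)

lemma complex_map_matrix_mult:
  fixes A :: "real^'d^'d" and a b :: "real^'d"
  shows "map_matrix complex_of_real A *v (\<chi> j. Complex (a $ j) (b $ j))
       = (\<chi> j. Complex ((A *v a) $ j) ((A *v b) $ j))"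
  by (simp add: vec_eq_iff matrix_vector_mult_def map_matrix_def complex_eq_iff)

text \<open>
  The eigenvector is \<open>w - \<i> K w / \<beta>\<close> with \<open>\<beta> = \<parallel>K w\<parallel>\<close>, where \<open>w\<close> is a unit vector
  in the top eigenspace of \<open>S\<close> with \<open>K\<^sup>2 w = - \<beta>\<^sup>2 w\<close>. On this vector \<open>S\<close> acts as \<open>m\<close> and
  \<open>K\<close> as \<open>\<i> \<beta>\<close>, and \<open>2 A = S + K\<close>.
\<close>

lemma normal_matrix_quadratic_bound:
  fixes A :: "real^'d^'d"
  assumes "normal_matrix A"
  obtains z where "complex_eigenvalue A z"
    "\<And>x. x \<bullet> (A *v x) \<le> Re z * (norm x)\<^sup>2"
proof -
  define B where "B = transpose A"
  define S where "S = (\<lambda>x. A *v x + B *v x)"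
  define K where "K = (\<lambda>x. A *v x - B *v x)"
  have AB: "A *v (B *v x) = B *v (A *v x)" for x
    using assms by (simp only: normal_matrix_def B_def matrix_vector_mul_assoc)
  have Bi: "(B *v x) \<bullet> y = x \<bullet> (A *v y)" "(A *v x) \<bullet> y = x \<bullet> (B *v y)" for x y
    using inner_transpose[of A x y] inner_transpose[of A y x]
    by (simp_all add: B_def inner_commute)
  have linS: "linear S" unfolding S_def
    by (intro linear_compose_add matrix_vector_mul_linear)
  have linK: "linear K" unfolding K_def
    by (intro linear_compose_sub matrix_vector_mul_linear)
  have linKK: "linear (\<lambda>x. K (K x))"
    using linear_compose[OF linK linK] by (simp add: o_def)
  have symS: "S x \<bullet> y = x \<bullet> S y" for x y by (simp add: S_def Bi inner_simps)
  have skewK: "K x \<bullet> y = - (x \<bullet> K y)" for x y by (simp add: K_def Bi inner_simps)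
  have SK: "S (K x) = K (S x)" for x
    by (simp add: S_def K_def AB matrix_vector_right_distrib matrix_vector_mult_diff_distrib)
  obtain m v where v: "norm v = 1" "S v = m *\<^sub>R v"
    and le: "\<And>y. y \<bullet> S y \<le> m * (norm y)\<^sup>2"
    by (rule selfadjoint_max_eigenvector[OF linS subspace_UNIV UNIV_not_singleton UNIV_I symS])
      auto
  define V where "V = {x. S x = m *\<^sub>R x}"
  have subV: "subspace V"
    by (auto simp: V_def subspace_def linear_0[OF linS] linear_add[OF linS]
        linear_cmul[OF linS] algebra_simps)
  have "v \<in> V" using v(2) by (simp add: V_def)
  moreover have "v \<noteq> 0" using v(1) by auto
  ultimately have V0: "V \<noteq> {0}" by blast
  have KV: "K (K x) \<in> V" if "x \<in> V" for x
    using that by (simp add: V_def SK linear_cmul[OF linK])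
  have symKK: "K (K x) \<bullet> y = x \<bullet> K (K y)" for x y by (simp add: skewK)
  obtain k w where w: "w \<in> V" "norm w = 1" and Kw: "K (K w) = k *\<^sub>R w"
    by (rule selfadjoint_max_eigenvector[OF linKK subV V0 KV symKK])
  define \<beta> where "\<beta> = norm (K w)"
  have "k = w \<bullet> K (K w)"
    using w(2) by (simp add: Kw norm_eq_1)
  also have "\<dots> = - \<beta>\<^sup>2"
    using skewK[of w "K w"] by (simp add: \<beta>_def power2_norm_eq_inner)
  finally have KKw: "K (K w) = - \<beta>\<^sup>2 *\<^sub>R w" using Kw by simp
  have Sw: "S w = m *\<^sub>R w" using w by (simp add: V_def)
  have SKw: "S (K w) = m *\<^sub>R K w" by (simp add: SK Sw linear_cmul[OF linK])
  have A2: "A *v x = (1/2) *\<^sub>R (S x + K x)" for x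
    by (simp add: S_def K_def flip: scaleR_2)
  \<comment> \<open>If \<open>\<beta> = 0\<close> then \<open>K w = 0\<close>, division by zero gives \<open>u = 0\<close>, and \<open>w\<close> is a real eigenvector.\<close>
  define u where "u = - ((1 / \<beta>) *\<^sub>R K w)"
  have bu: "K w = - \<beta> *\<^sub>R u" by (cases "\<beta> = 0") (auto simp: u_def \<beta>_def)
  have Su: "S u = m *\<^sub>R u"
    by (simp add: u_def linear_neg[OF linS] linear_cmul[OF linS] SKw)
  have Ku: "K u = \<beta> *\<^sub>R w"
    by (simp add: u_def linear_neg[OF linK] linear_cmul[OF linK] KKw power2_eq_square)
  have Aw: "A *v w = (m/2) *\<^sub>R w - (\<beta>/2) *\<^sub>R u" by (simp add: A2 Sw bu algebra_simps)
  have Au: "A *v u = (m/2) *\<^sub>R u + (\<beta>/2) *\<^sub>R w" by (simp add: A2 Su Ku algebra_simps)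
  define c :: "complex^'d" where "c = (\<chi> j. Complex (w $ j) (u $ j))"
  have "c \<noteq> 0"
  proof
    assume "c = 0"
    then have "w = 0" by (simp add: c_def vec_eq_iff complex_eq_iff)
    with w(2) show False by simp
  qed
  moreover have "map_matrix complex_of_real A *v c = Complex (m/2) (\<beta>/2) *s c"
    unfolding c_def complex_map_matrix_mult
    by (simp add: Aw Au vec_eq_iff complex_eq_iff)
  ultimately have "complex_eigenvalue A (Complex (m/2) (\<beta>/2))"
    unfolding complex_eigenvalue_def by blast
  moreover have "x \<bullet> (A *v x) \<le> Re (Complex (m/2) (\<beta>/2)) * (norm x)\<^sup>2" for x
  proof -
    have "x \<bullet> K x = 0" using skewK[of x x] by (simp add: inner_commute)
    then show ?thesis using le[of x] by (simp add: A2 inner_simps)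
  qed
  ultimately show thesis using that by blast
qed

lemma uniformly_dissipative_if_normal_hurwitz:
  fixes A :: "nat \<Rightarrow> real^'d^'d"
  assumes "\<And>i. i < n \<Longrightarrow> normal_matrix (A i) \<and> hurwitz (A i)"
  obtains c where "c > 0" "\<And>i v. i < n \<Longrightarrow> v \<bullet> (A i *v v) \<le> - c * (norm v)\<^sup>2"
proof -
  have "\<exists>c>0. \<forall>v. v \<bullet> (A i *v v) \<le> - c * (norm v)\<^sup>2" if i: "i < n" for i
  proof -
    obtain z where z: "complex_eigenvalue (A i) z"
      "\<And>v. v \<bullet> (A i *v v) \<le> Re z * (norm v)\<^sup>2"
      using normal_matrix_quadratic_bound assms[OF i] by blast
    have "Re z < 0" using z(1) assms[OF i] by (auto simp: hurwitz_def)
    then show ?thesis using z(2) by (intro exI[of _ "- Re z"]) simp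
  qed
  then obtain c where c: "\<And>i. i < n \<Longrightarrow> c i > 0"
    "\<And>i v. i < n \<Longrightarrow> v \<bullet> (A i *v v) \<le> - c i * (norm v)\<^sup>2" by metis
  define c0 where "c0 = Min (insert 1 (c ` {..<n}))"
  have "c0 > 0" using c(1) by (simp add: c0_def)
  moreover have "v \<bullet> (A i *v v) \<le> - c0 * (norm v)\<^sup>2" if i: "i < n" for i v
  proof -
    have "c0 \<le> c i" using i by (simp add: c0_def)
    then have "- c i * (norm v)\<^sup>2 \<le> - c0 * (norm v)\<^sup>2" by (simp add: mult_right_mono)
    then show ?thesis using c(2)[OF i, of v] by linarith
  qed
  ultimately show thesis using that by blast
qed

section \<open>Decay along one trajectory\<close>

lemma decreasing_if_deriv_nonpos_except_finite:
  fixes g g' :: "real \<Rightarrow> real"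
  assumes "finite F" "a \<le> b" "continuous_on {a..b} g"
    and deriv: "\<And>t. t \<in> {a<..<b} - F \<Longrightarrow> (g has_vector_derivative g' t) (at t)"
    and nonpos: "\<And>t. t \<in> {a<..<b} - F \<Longrightarrow> g' t \<le> 0"
  shows "g b \<le> g a"
proof -
  let ?F = "insert a (insert b F)"
  \<comment> \<open>The value at the exceptional points is free, so it is taken to be 0.\<close>
  let ?h = "\<lambda>t. if t \<in> ?F then 0 else g' t"
  have "(?h has_integral (g b - g a)) {a..b}"
    using assms by (intro fundamental_theorem_of_calculus_interior_strong[of ?F]) auto
  moreover have "((\<lambda>_. 0::real) has_integral 0) {a..b}" by simp
  ultimately have "g b - g a \<le> 0"
    by (rule has_integral_le) (use nonpos in \<open>auto simp: less_le\<close>)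
  then show ?thesis by simp
qed

lemma switched_ode_integrable:
  assumes "solves_switched_ode A i x"
  shows "(\<lambda>s. A (i s) *v x s) integrable_on {0..T}"
  using assms by (cases "T \<ge> 0") (auto simp: solves_switched_ode_def)

lemma switched_ode_integral_form:
  assumes "solves_switched_ode A i x" "t \<ge> 0"
  shows "x 0 + integral {0..t} (\<lambda>s. A (i s) *v x s) = x t"
  using assms unfolding solves_switched_ode_def by metis

lemma switched_ode_continuous:
  assumes "solves_switched_ode A i x"
  shows "continuous_on {0..T} x"
proof -
  let ?f = "\<lambda>s. A (i s) *v x s"
  have "continuous_on {0..T} (\<lambda>s. x 0 + integral {0..s} ?f)"
    by (intro continuous_intros indefinite_integral_continuous_1 switched_ode_integrable assms)
  then show ?thesis
    by (rule continuous_on_eq) (use switched_ode_integral_form[OF assms] in auto)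
qed

text \<open>
  Between jump times the integrand of the integral equation is continuous, so there the equation
  can be differentiated.
\<close>

lemma switched_ode_has_derivative:
  fixes A :: "nat \<Rightarrow> real^'d^'d"
  assumes ode: "solves_switched_ode A i x" and path: "jump_path i"
    and t: "0 < t" and left: "\<forall>\<^sub>F s in at_left t. i s = i t"
  shows "(x has_vector_derivative A (i t) *v x t) (at t)"
proof -
  let ?f = "\<lambda>s. A (i s) *v x s"
  note int = switched_ode_integrable[OF ode]
  note cont = switched_ode_continuous[OF ode]
  note x = switched_ode_integral_form[OF ode]
  have xt: "(x \<longlongrightarrow> x t) (at t)"
    using continuous_on_interior[OF cont[of "t + 1"], of t] t
    by (simp add: isCont_def)
  have "\<forall>\<^sub>F s in at_right t. i s = i t"
    using path t by (simp add: jump_path_def)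
  with left have "\<forall>\<^sub>F s in at t. i s = i t"
    by (simp add: eventually_at_split)
  then have ev: "\<forall>\<^sub>F s in at t. A (i t) *v x s = ?f s"
    by eventually_elim simp
  have "((\<lambda>s. A (i t) *v x s) \<longlongrightarrow> A (i t) *v x t) (at t)"
    by (rule bounded_linear.tendsto[OF matrix_vector_mul_bounded_linear xt])
  then have "isCont ?f t"
    unfolding isCont_def by (rule Lim_transform_eventually[OF _ ev])
  then have "((\<lambda>s. integral {0..s} ?f) has_vector_derivative ?f t) (at t within {0..t+1})"
    using t int
    by (intro integral_has_vector_derivative_continuous_at[where S="{}", simplified])
      (auto intro: continuous_at_imp_continuous_at_within)
  then have "((\<lambda>s. integral {0..s} ?f) has_vector_derivative ?f t) (at t)"
    using t by (simp add: at_within_Icc_at)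
  then have "((\<lambda>s. x 0 + integral {0..s} ?f) has_vector_derivative ?f t) (at t)"
    using has_vector_derivative_add[OF has_vector_derivative_const] by fastforce
  then show ?thesis
    by (rule has_vector_derivative_transform_within_open[of _ _ _ "{0<..}"]) (use t x in auto)
qed

lemma switched_trajectory_decay:
  fixes A :: "nat \<Rightarrow> real^'d^'d"
  assumes ode: "solves_switched_ode A i x" and path: "jump_path i"
    and diss: "\<And>t v. t \<ge> 0 \<Longrightarrow> v \<bullet> (A (i t) *v v) \<le> - c * (norm v)\<^sup>2"
    and st: "0 \<le> s" "s \<le> t"
  shows "exp (c * t) * norm (x t) \<le> exp (c * s) * norm (x s)"
proof -
  \<comment> \<open>The square of the claimed quantity: it stays differentiable where \<open>x\<close> vanishes.\<close>
  define g where "g t = exp (2 * c * t) * (x t \<bullet> x t)" for t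
  define g' where "g' t = exp (2 * c * t) * (2 * c * (x t \<bullet> x t) + 2 * (x t \<bullet> (A (i t) *v x t)))" for t
  define F where "F = {u. 0 < u \<and> u \<le> t \<and> \<not> (\<forall>\<^sub>F v in at_left u. i v = i u)}"
  have "finite F"
    \<comment> \<open>The path condition speaks of positive times only, and \<open>t\<close> may be 0.\<close>
  proof (rule finite_subset)
    show "finite {u. 0 < u \<and> u \<le> t + 1 \<and> \<not> (\<forall>\<^sub>F v in at_left u. i v = i u)}"
      using path st by (simp add: jump_path_def)
  qed (auto simp: F_def)
  moreover have "continuous_on {s..t} g"
    using st unfolding g_def
    by (intro continuous_intros continuous_on_subset[OF switched_ode_continuous[OF ode]])
      auto
  moreover have "(g has_vector_derivative g' u) (at u)" if "u \<in> {s<..<t} - F" for u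
  proof -
    have "(x has_vector_derivative A (i u) *v x u) (at u)"
      using that st by (intro switched_ode_has_derivative[OF ode path]) (auto simp: F_def)
    then show ?thesis
      unfolding g_def g'_def has_vector_derivative_def
      by (auto intro!: derivative_eq_intros simp: inner_commute algebra_simps)
  qed
  moreover have "g' u \<le> 0" if "u \<in> {s<..<t} - F" for u
    using diss[of u "x u"] that st
    by (auto simp: g'_def power2_norm_eq_inner intro!: mult_nonneg_nonpos)
  ultimately have "g t \<le> g s"
    using st by (intro decreasing_if_deriv_nonpos_except_finite[of F s t g g'])
  moreover have "g u = (exp (c * u) * norm (x u))\<^sup>2" for u
    by (simp add: g_def power_mult_distrib power2_norm_eq_inner flip: exp_double)
  ultimately show ?thesis by (auto intro: power2_le_imp_le)
qed

section \<open>Almost sure monotone decay\<close>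

theorem theorem2p1:
  fixes M :: "'w measure"
    and n :: nat
    and Q :: "nat \<Rightarrow> nat \<Rightarrow> real"
    and r :: real
    and A :: "nat \<Rightarrow> real^'d^'d"
    and X :: "real \<Rightarrow> 'w \<Rightarrow> real^'d"
    and I :: "real \<Rightarrow> 'w \<Rightarrow> nat"
  assumes "prob_space M"
    and "irreducible_generator n Q"
    and "r > 0"
    and "switched_system M n (\<lambda>i j. r * Q i j) A X I"
    and "integrable M (\<lambda>\<omega>. norm (X 0 \<omega>))"
    and "\<forall>i<n. normal_matrix (A i) \<and> hurwitz (A i)"
  shows "AE \<omega> in M. antimono_on {0..} (\<lambda>t. norm (X t \<omega>)) \<and>
                    ((\<lambda>t. norm (X t \<omega>)) \<longlongrightarrow> 0) at_top"
proof -
  obtain c where c: "c > 0"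
    and diss: "\<And>i v. i < n \<Longrightarrow> v \<bullet> (A i *v v) \<le> - c * (norm v)\<^sup>2"
    using uniformly_dissipative_if_normal_hurwitz[of n A] assms(6) by blast
  have "AE \<omega> in M. jump_path (\<lambda>t. I t \<omega>)"
    and "AE \<omega> in M. solves_switched_ode A (\<lambda>t. I t \<omega>) (\<lambda>t. X t \<omega>)"
    using assms(4) by (auto simp: switched_system_def markov_jump_process_def)
  then show ?thesis using AE_space
  proof eventually_elim
    case (elim \<omega>)
    have state: "I t \<omega> < n" if "t \<ge> 0" for t
    proof -
      have "I t \<in> M \<rightarrow>\<^sub>M count_space {..<n}"
        using assms(4) that by (simp add: switched_system_def)
      from measurable_space[OF this elim(3)] show ?thesis by simp
    qed
    have decay: "exp (c * t) * norm (X t \<omega>) \<le> exp (c * s) * norm (X s \<omega>)"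
      if "0 \<le> s" "s \<le> t" for s t
      by (rule switched_trajectory_decay[OF elim(2,1)]) (use diss state that in auto)
    have "norm (X t \<omega>) \<le> norm (X s \<omega>)" if st: "0 \<le> s" "s \<le> t" for s t
    proof -
      have "exp (c * s) * norm (X t \<omega>) \<le> exp (c * t) * norm (X t \<omega>)"
        using c st by (intro mult_right_mono) auto
      also note decay[OF st]
      finally show ?thesis by simp
    qed
    then have "antimono_on {0..} (\<lambda>t. norm (X t \<omega>))"
      by (auto intro!: monotone_onI)
    moreover have "((\<lambda>t. norm (X t \<omega>)) \<longlongrightarrow> 0) at_top"
    proof (rule tendsto_sandwich)
      show "((\<lambda>_. 0::real) \<longlongrightarrow> 0) at_top" by simp
      show "\<forall>\<^sub>F t in at_top. 0 \<le> norm (X t \<omega>)" by simp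
      show "\<forall>\<^sub>F t in at_top. norm (X t \<omega>) \<le> exp (- (c * t)) * norm (X 0 \<omega>)"
        using eventually_ge_at_top[of 0]
      proof eventually_elim
        case (elim t)
        then show ?case using decay[of 0 t] by (simp add: exp_minus field_simps)
      qed
      have "((\<lambda>t. exp (- (c * t))) \<longlongrightarrow> 0) at_top"
        using c by real_asymp
      then show "((\<lambda>t. exp (- (c * t)) * norm (X 0 \<omega>)) \<longlongrightarrow> 0) at_top"
        by (rule tendsto_mult_left_zero)
    qed
    ultimately show ?case by blast
  qed
qed

end
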